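(* Let $X$ be a complex Banach space, $\alpha>0$, and suppose that $\{S_\alpha(t)\}_{t\ge0}$ is a (non-degenerate) $\alpha$-times integrated semigroup on $X$ generated by $(A,D(A))$ such that $\|S_\alpha(t)\|\le Ce^{\omega t}$ for $t\ge 0$, with $C>0$ and $0\le\omega<1$. Then $1\in\rho(A)$ and, writing $R:=(1-A)^{-1}$ and $\mathcal{R}(n)=R^n$, for every $x\in X$, $$\Delta^{-\alpha}\mathcal{R}(n)x=(I-A)\int_0^\infty\frac{e^{-t}t^n}{n!}S_\alpha(t)x\,dt,\qquad n\in\mathbb{N}_0,$$ $$\Delta^{-\alpha}\mathcal{R}(n)x=\int_0^\infty\frac{e^{-t}t^{n-1}}{(n-1)!}S_\alpha(t)x\,dt+k^{\alpha+1}(n)x-k^{\alpha+1}(n-1)x,\qquad n\ge1.$$ In particular, if $\{S_\alpha(t)\}_{t\ge0}$ has temperated growth, i.e. $\|S_\alpha(t)\|\le Ct^\alpha$ for $t>0$, then $(I-A)^{-1}$ is a $(C,\alpha)$-bounded operator.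
   Context: $\mathbb{N}_0=\{0,1,2,\dots\}$; $\mathcal{B}(X)$ is the algebra of bounded linear operators on $X$. For $\alpha>0$, $k^\alpha(n)=\frac{\Gamma(n+\alpha)}{\Gamma(\alpha)\Gamma(n+1)}$; $\Delta^{-\alpha}\mathcal{R}(n)=\sum_{j=0}^nk^\alpha(n-j)R^j$ (with $R^0=I$). An operator $T\in\mathcal{B}(X)$ is $(C,\alpha)$-bounded if $\sup_n\frac{1}{k^{\alpha+1}(n)}\big\|\sum_{j=0}^nk^\alpha(n-j)T^j\big\|<\infty$. An $\alpha$-times integrated semigroup is a family $\{S_\alpha(t)\}_{t\ge0}\subset\mathcal{B}(X)$ with $S_\alpha(0)=0$, $t\mapsto S_\alpha(t)x$ continuous on $[0,\infty)$ for every $x\in X$, and $$S_\alpha(t)S_\alpha(s)x=\frac{1}{\Gamma(\alpha)}\left(\int_t^{t+s}(t+s-r)^{\alpha-1}S_\alpha(r)x\,dr-\int_0^s(t+s-r)^{\alpha-1}S_\alpha(r)x\,dr\right),\quad t,s>0,\ x\in X.$$ It is non-degenerate if $S_\alpha(t)x=0$ for all $t>0$ implies $x=0$. If it is non-degenerate and $\|S_\alpha(t)\|\le Ce^{\omega t}$, its generator is the closed operator $(A,D(A))$ such that $(\lambda-A)^{-1}x=\lambda^\alpha\int_0^\infty e^{-\lambda t}S_\alpha(t)x\,dt$ for $\Re\lambda>\omega$, $x\in X$ (in particular such $\lambda$ belong to $\rho(A)$). *)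

theory Defs
  imports "HOL-Analysis.Analysis"
begin

section \<open>Complex Banach spaces and their operators\<close>

text \<open>The class \<open>banach\<close> is real; we add a complex scalar multiplication that extends the
  real one and for which the norm is homogeneous.\<close>

class complex_banach = banach +
  fixes scaleC :: "complex \<Rightarrow> 'a \<Rightarrow> 'a"  (infixr "*\<^sub>C" 75)
  assumes scaleC_add_right: "c *\<^sub>C (x + y) = c *\<^sub>C x + c *\<^sub>C y"
    and scaleC_add_left: "(c + d) *\<^sub>C x = c *\<^sub>C x + d *\<^sub>C x"
    and scaleC_scaleC: "c *\<^sub>C d *\<^sub>C x = (c * d) *\<^sub>C x"
    and scaleC_of_real: "complex_of_real r *\<^sub>C x = r *\<^sub>R x"
    and norm_scaleC: "norm (c *\<^sub>C x) = cmod c * norm x"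

instantiation complex :: complex_banach
begin

definition scaleC_complex :: "complex \<Rightarrow> complex \<Rightarrow> complex"
  where "scaleC_complex c z = c * z"

instance
  by standard (simp_all add: scaleC_complex_def algebra_simps norm_mult scaleR_conv_of_real)

end

text \<open>Operators are plain functions; their norm is \<^const>\<open>onorm\<close>.\<close>

definition bounded_clinear :: "('a::complex_banach \<Rightarrow> 'a) \<Rightarrow> bool"
  where "bounded_clinear T \<longleftrightarrow> bounded_linear T \<and> (\<forall>c x. T (c *\<^sub>C x) = c *\<^sub>C T x)"

text \<open>An unbounded operator is given by a domain \<open>D\<close> and a function \<open>A\<close> whose values outside
  \<open>D\<close> are irrelevant.\<close>

definition closed_operator :: "'a::complex_banach set \<Rightarrow> ('a \<Rightarrow> 'a) \<Rightarrow> bool"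
  where "closed_operator D A \<longleftrightarrow>
    0 \<in> D \<and>
    (\<forall>x\<in>D. \<forall>y\<in>D. x + y \<in> D \<and> A (x + y) = A x + A y) \<and>
    (\<forall>c. \<forall>x\<in>D. c *\<^sub>C x \<in> D \<and> A (c *\<^sub>C x) = c *\<^sub>C A x) \<and>
    closed {(x, A x) |x. x \<in> D}"

definition resolvent :: "'a::complex_banach set \<Rightarrow> ('a \<Rightarrow> 'a) \<Rightarrow> complex \<Rightarrow> 'a \<Rightarrow> 'a"
  where "resolvent D A l = the_inv_into D (\<lambda>x. l *\<^sub>C x - A x)"

definition resolvent_set :: "'a::complex_banach set \<Rightarrow> ('a \<Rightarrow> 'a) \<Rightarrow> complex set"
  where "resolvent_set D A =
    {l. bij_betw (\<lambda>x. l *\<^sub>C x - A x) D UNIV \<and> bounded_clinear (resolvent D A l)}"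


section \<open>Fractional sums and Cesaro boundedness\<close>

definition cesaro_kernel :: "real \<Rightarrow> nat \<Rightarrow> real"
  where "cesaro_kernel \<alpha> n = Gamma (real n + \<alpha>) / (Gamma \<alpha> * Gamma (real n + 1))"

definition frac_sum :: "real \<Rightarrow> (nat \<Rightarrow> 'a \<Rightarrow> 'a) \<Rightarrow> nat \<Rightarrow> 'a \<Rightarrow> 'a::complex_banach"
  where "frac_sum \<alpha> F n x = (\<Sum>j\<le>n. cesaro_kernel \<alpha> (n - j) *\<^sub>R F j x)"

definition cesaro_bounded :: "real \<Rightarrow> ('a::complex_banach \<Rightarrow> 'a) \<Rightarrow> bool"
  where "cesaro_bounded \<alpha> T \<longleftrightarrow> bounded_clinear T \<and>
    bdd_above (range (\<lambda>n. 1 / cesaro_kernel (\<alpha> + 1) n * onorm (frac_sum \<alpha> (\<lambda>j. T ^^ j) n)))"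


section \<open>Integrated semigroups\<close>

text \<open>Vector-valued integrals are Henstock--Kurzweil integrals, because the library's Bochner
  integral requires a second countable (hence separable) range. All integrands below are
  continuous except possibly for an integrable singularity at an endpoint, and are dominated
  in norm by an integrable scalar function (under the exponential bound, for the integrals
  over the half-line), so the two integrals agree.\<close>

definition integrated_semigroup :: "real \<Rightarrow> (real \<Rightarrow> 'a::complex_banach \<Rightarrow> 'a) \<Rightarrow> bool"
  where "integrated_semigroup \<alpha> S \<longleftrightarrow>
    (\<forall>t\<ge>0. bounded_clinear (S t)) \<and>
    (\<forall>x. S 0 x = 0) \<and>
    (\<forall>x. continuous_on {0..} (\<lambda>t. S t x)) \<and>
    (\<forall>t>0. \<forall>s>0. \<forall>x. S t (S s x) =
       (1 / Gamma \<alpha>) *\<^sub>R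
         (integral {t..t + s} (\<lambda>r. (t + s - r) powr (\<alpha> - 1) *\<^sub>R S r x)
          - integral {0..s} (\<lambda>r. (t + s - r) powr (\<alpha> - 1) *\<^sub>R S r x)))"

definition nondegenerate :: "(real \<Rightarrow> 'a::complex_banach \<Rightarrow> 'a) \<Rightarrow> bool"
  where "nondegenerate S \<longleftrightarrow> (\<forall>x. (\<forall>t>0. S t x = 0) \<longrightarrow> x = 0)"

text \<open>Meaningful when \<open>S\<close> is non-degenerate and \<open>onorm (S t) \<le> C * exp (\<omega> * t)\<close> with
  \<open>\<omega> \<ge> 0\<close>; the power of \<open>l\<close> is then the principal branch on the right half-plane.\<close>

definition generator ::
    "real \<Rightarrow> real \<Rightarrow> (real \<Rightarrow> 'a::complex_banach \<Rightarrow> 'a) \<Rightarrow> 'a set \<Rightarrow> ('a \<Rightarrow> 'a) \<Rightarrow> bool"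
  where "generator \<alpha> \<omega> S D A \<longleftrightarrow> closed_operator D A \<and>
    (\<forall>l. Re l > \<omega> \<longrightarrow> l \<in> resolvent_set D A \<and>
      (\<forall>x. resolvent D A l x =
         (l powr complex_of_real \<alpha>) *\<^sub>C
           integral {0..} (\<lambda>t. exp (- l * complex_of_real t) *\<^sub>C S t x)))"

definition temperate_growth :: "real \<Rightarrow> (real \<Rightarrow> 'a::complex_banach \<Rightarrow> 'a) \<Rightarrow> bool"
  where "temperate_growth \<alpha> S \<longleftrightarrow> (\<exists>K. \<forall>t>0. onorm (S t) \<le> K * t powr \<alpha>)"

end

theory Submission
  imports Defs
begin

text \<open>Let \<open>R\<close> be the resolvent at \<open>1\<close> and write \<open>J n x\<close> for the integral of \<open>exp (- t) * t ^ n / fact n\<close> against \<open>S t x\<close>. For small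
  \<open>h > 0\<close> the Laplace transform \<open>y h\<close> of \<open>S t x\<close> at \<open>1 - h\<close> is the power series in \<open>h\<close> with
  coefficients \<open>J n x\<close>, and, since it equals the resolvent at \<open>1 - h\<close> up to the factor
  \<open>(1 - h) powr - \<alpha>\<close>, it satisfies \<open>y h - h *\<^sub>R R (y h) = (1 - h) powr - \<alpha> *\<^sub>R R x\<close>. The
  fractional kernel is the coefficient sequence of \<open>(1 - h) powr - \<alpha>\<close>, so comparing coefficients
  gives a recursion that \<open>R\<close> applied to the fractional sums also satisfies. The
  Cesaro bound follows because under temperate growth \<open>J n\<close> is controlled by a Gamma integral.\<close>

section \<open>Uniqueness of coefficients of vector-valued power series\<close>

text \<open>Once the lower coefficients vanish, dividing by \<open>h ^ n\<close> makes
  \<open>a n\<close> the constant term; it is then cancelled by a tail that tends to 0 with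
  \<open>h\<close>. Positive \<open>h\<close> suffices, which is the range where the Laplace
  identities are compared.\<close>

lemma powser_zero_coeff:
  fixes a :: "nat \<Rightarrow> 'a::banach"
  assumes "r > 0" and sums: "\<And>h::real. 0 < h \<Longrightarrow> h < r \<Longrightarrow> (\<lambda>n. h ^ n *\<^sub>R a n) sums 0"
  shows "a n = 0"
proof (induction n rule: less_induct)
  case (less n)
  define b where "b k = a (k + n)" for k
  have b: "(\<lambda>k. h ^ k *\<^sub>R b k) sums 0" if h: "0 < h" "h < r" for h
  proof -
    have "(\<lambda>k. h ^ (k + n) *\<^sub>R a (k + n)) sums 0"
      using sums[OF h] less by (subst sums_iff_shift) simp
    then have "(\<lambda>k. inverse (h ^ n) *\<^sub>R h ^ (k + n) *\<^sub>R a (k + n)) sums (inverse (h ^ n) *\<^sub>R 0)"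
      by (rule sums_scaleR_right)
    then show ?thesis
      using h by (simp add: b_def power_add field_simps)
  qed
  \<comment> \<open>A reference point inside the interval: the terms at \<open>s\<close> are bounded
    by some \<open>M\<close>, so at \<open>q * s\<close> the tail is dominated by a geometric series
    of ratio \<open>q\<close>, and \<open>q\<close> can be sent to 0.\<close>
  define s where "s = r / 2"
  have s: "0 < s" "s < r" using \<open>r > 0\<close> by (auto simp: s_def)
  obtain M where M: "M > 0" "\<And>k. norm (s ^ k *\<^sub>R b k) \<le> M"
    using sums_summable[OF b[OF s], THEN summable_imp_Bseq] by (auto simp: Bseq_def)
  have bound: "norm (b 0) \<le> q / (1 - q) * M" if q: "0 < q" "q < 1" for q
  proof -
    have "(\<lambda>k. (q * s) ^ k *\<^sub>R b k) sums 0"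
      using q s by (intro b) (auto intro: less_trans[of "q * s" s])
    then have S: "(\<lambda>k. (q * s) ^ Suc k *\<^sub>R b (Suc k)) sums (0 - b 0)"
      by (subst sums_Suc_iff) simp
    have "(\<lambda>k. q ^ k) sums (1 / (1 - q))"
      using q by (intro geometric_sums) auto
    from sums_mult[OF this, of "q * M"] have G: "(\<lambda>k. q ^ Suc k * M) sums (q / (1 - q) * M)"
      by (simp add: mult_ac)
    have "norm (\<Sum>k. (q * s) ^ Suc k *\<^sub>R b (Suc k)) \<le> (\<Sum>k. q ^ Suc k * M)"
    proof (rule norm_suminf_le[OF _ sums_summable[OF G]])
      fix k
      have "norm ((q * s) ^ Suc k *\<^sub>R b (Suc k)) = q ^ Suc k * norm (s ^ Suc k *\<^sub>R b (Suc k))"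
        using q by (simp add: power_mult_distrib abs_mult)
      also have "\<dots> \<le> q ^ Suc k * M"
        using q by (intro mult_left_mono M) auto
      finally show "norm ((q * s) ^ Suc k *\<^sub>R b (Suc k)) \<le> q ^ Suc k * M" .
    qed
    then show ?thesis
      unfolding sums_unique[OF S, symmetric] sums_unique[OF G, symmetric] by simp
  qed
  have "((\<lambda>q. q / (1 - q) * M) \<longlongrightarrow> 0 / (1 - 0) * M) (at_right 0)"
    by (intro tendsto_intros) auto
  moreover have "eventually (\<lambda>q. norm (b 0) \<le> q / (1 - q) * M) (at_right 0)"
    using eventually_at_right_real[OF zero_less_one] 
    by eventually_elim (rule bound, auto)
  ultimately have "norm (b 0) \<le> 0 / (1 - 0) * M"
    by (rule tendsto_lowerbound) simp
  then show ?case by (simp add: b_def)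
qed

section \<open>Exponentially dominated integrals and the expansion of the Laplace transform\<close>

lemma power_div_fact_le_exp:
  fixes x :: real
  assumes "x \<ge> 0"
  shows "x ^ n / fact n \<le> exp x"
proof -
  obtain t where "exp x = (\<Sum>m<Suc n. x ^ m / fact m) + exp t / fact (Suc n) * x ^ Suc n"
    using Maclaurin_exp_le[of x "Suc n"] by blast
  moreover have "(\<Sum>m<n. x ^ m / fact m) \<ge> 0" "exp t / fact (Suc n) * x ^ Suc n \<ge> 0"
    using assms by (auto intro!: sum_nonneg)
  ultimately show ?thesis by simp
qed

text \<open>Lagrange remainder: the intermediate point is at most \<open>x\<close>, so its
  exponential is at most \<open>exp x\<close>.\<close>

lemma exp_taylor_remainder:
  fixes x :: real
  assumes "x \<ge> 0"
  shows "0 \<le> exp x - (\<Sum>m<n. x ^ m / fact m)"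
    and "exp x - (\<Sum>m<n. x ^ m / fact m) \<le> exp x * x ^ n / fact n"
proof -
  obtain t where t: "\<bar>t\<bar> \<le> \<bar>x\<bar>" "exp x = (\<Sum>m<n. x ^ m / fact m) + exp t / fact n * x ^ n"
    using Maclaurin_exp_le[of x n] by blast
  then show "0 \<le> exp x - (\<Sum>m<n. x ^ m / fact m)"
    using assms by (simp only: add_diff_cancel_left') simp
  have "exp t \<le> exp x" using t(1) assms by simp
  then have "exp t * (x ^ n / fact n) \<le> exp x * (x ^ n / fact n)"
    using assms by (intro mult_right_mono) auto
  then show "exp x - (\<Sum>m<n. x ^ m / fact m) \<le> exp x * x ^ n / fact n"
    by (subst t(2)) (simp only: add_diff_cancel_left' times_divide_eq_right times_divide_eq_left)
qed

text \<open>The exponential rates of the two factors add up to a negative number, so a decaying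
  exponential with explicit integral dominates the product.\<close>

lemma integral_exp_dominated:
  fixes f :: "real \<Rightarrow> 'a::banach" and g :: "real \<Rightarrow> real"
  assumes cont: "continuous_on {0..} f" "continuous_on {0..} g"
    and f: "\<And>t. t \<ge> 0 \<Longrightarrow> norm (f t) \<le> M * exp (\<omega> * t)"
    and g: "\<And>t. t \<ge> 0 \<Longrightarrow> \<bar>g t\<bar> \<le> B * exp (c * t)"
    and c: "\<omega> + c < 0"
  shows "(\<lambda>t. g t *\<^sub>R f t) integrable_on {0..}"
    and "norm (integral {0..} (\<lambda>t. g t *\<^sub>R f t)) \<le> B * M / (- (\<omega> + c))"
proof -
  have "((\<lambda>t. exp (- (- (\<omega> + c)) * t)) has_integral
      exp (- (- (\<omega> + c)) * 0) / (- (\<omega> + c))) {0..}"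
    using c by (intro has_integral_exp_minus_to_infinity) auto
  from has_integral_mult_right[OF this, of "B * M"]
  have E: "((\<lambda>t. B * M * exp ((\<omega> + c) * t)) has_integral B * M / (- (\<omega> + c))) {0..}"
    by (simp only: minus_minus mult_zero_right exp_zero times_divide_eq_right mult_1_right)
  have le: "norm (g t *\<^sub>R f t) \<le> B * M * exp ((\<omega> + c) * t)" if "t \<in> {0..}" for t
  proof -
    have "norm (g t *\<^sub>R f t) \<le> (B * exp (c * t)) * (M * exp (\<omega> * t))"
      using that f[of t] g[of t] order_trans[OF abs_ge_zero g[of t]]
      by (auto intro!: mult_mono)
    also have "\<dots> = B * M * exp ((\<omega> + c) * t)"
      by (simp add: distrib_right exp_add)
    finally show ?thesis .
  qed
  show int: "(\<lambda>t. g t *\<^sub>R f t) integrable_on {0..}"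
  proof (rule integrable_on_all_intervals_integrable_bound[OF _ le has_integral_integrable[OF E]])
    \<comment> \<open>Extended by zero, the integrand on \<open>{a..b}\<close> is supported in
      \<open>{max a 0..b}\<close>, where continuity gives integrability.\<close>
    fix a b :: real
    have "(\<lambda>t. g t *\<^sub>R f t) integrable_on {max a 0..b}"
      by (intro integrable_continuous_real continuous_intros continuous_on_subset[OF cont(1)]
          continuous_on_subset[OF cont(2)]) auto
    moreover have "{0..} \<inter> cbox a b = {max a 0..b}" by auto
    ultimately show "(\<lambda>t. if t \<in> {0..} then g t *\<^sub>R f t else 0) integrable_on cbox a b"
      by (simp only: integrable_restrict_Int)
  qed
  show "norm (integral {0..} (\<lambda>t. g t *\<^sub>R f t)) \<le> B * M / (- (\<omega> + c))"
    using integral_norm_bound_integral[OF int has_integral_integrable[OF E] le] integral_unique[OF E]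
    by simp
qed

text \<open>Trades a power of \<open>t\<close> for an exponential of arbitrarily small rate
  \<open>b\<close>; the price \<open>inverse (b ^ n)\<close> later supplies the ratio
  \<open>h / b\<close>.\<close>

lemma power_exp_dominated:
  fixes b t :: real
  assumes "b > 0" "t \<ge> 0"
  shows "t ^ n / fact n \<le> inverse (b ^ n) * exp (b * t)"
proof -
  have "t ^ n / fact n = inverse (b ^ n) * ((b * t) ^ n / fact n)"
    using assms by (simp add: power_mult_distrib)
  also have "\<dots> \<le> inverse (b ^ n) * exp (b * t)"
    using assms by (intro mult_left_mono power_div_fact_le_exp) auto
  finally show ?thesis .
qed

lemma integrable_exp_moment:
  fixes f :: "real \<Rightarrow> 'a::banach"
  assumes cont: "continuous_on {0..} f"
    and f: "\<And>t. t \<ge> 0 \<Longrightarrow> norm (f t) \<le> M * exp (\<omega> * t)" and "\<omega> < 1"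
  shows "(\<lambda>t. (exp (- t) * t ^ n / fact n) *\<^sub>R f t) integrable_on {0..}"
proof (rule integral_exp_dominated(1)[OF cont _ f])
  \<comment> \<open>Half of the gap between \<open>\<omega>\<close> and 1: absorbing
    \<open>t ^ n\<close> at this rate still leaves total rate \<open>- b\<close>.\<close>
  define b where "b = (1 - \<omega>) / 2"
  have b: "b > 0" using \<open>\<omega> < 1\<close> by (simp add: b_def)
  show "continuous_on {0..} (\<lambda>t::real. exp (- t) * t ^ n / fact n)"
    by (intro continuous_intros) auto
  show "\<bar>exp (- t) * t ^ n / fact n\<bar> \<le> inverse (b ^ n) * exp ((b - 1) * t)" if "t \<ge> 0" for t
  proof -
    have "exp (- t) * (t ^ n / fact n) \<le> exp (- t) * (inverse (b ^ n) * exp (b * t))"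
      by (intro mult_left_mono power_exp_dominated b that) auto
    also have "\<dots> = inverse (b ^ n) * exp ((b - 1) * t)"
      by (simp add: algebra_simps flip: exp_add)
    finally show ?thesis
      using that by simp
  qed
  show "\<omega> + (b - 1) < 0" using \<open>\<omega> < 1\<close> by (simp add: b_def field_simps)
qed

text \<open>Factor the weight as \<open>exp (- t) * exp (h * t)\<close> and expand the second
  exponential. Interchange of sum and integral is justified by bounding the integrated Taylor
  remainder by a multiple of \<open>(h / b) ^ N\<close>.\<close>

lemma laplace_sums_exp_moments:
  fixes f :: "real \<Rightarrow> 'a::banach"
  assumes cont: "continuous_on {0..} f"
    and f: "\<And>t. t \<ge> 0 \<Longrightarrow> norm (f t) \<le> M * exp (\<omega> * t)"
    and h: "0 < h" "h < (1 - \<omega>) / 2"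
  shows "(\<lambda>n. h ^ n *\<^sub>R integral {0..} (\<lambda>t. (exp (- t) * t ^ n / fact n) *\<^sub>R f t))
    sums integral {0..} (\<lambda>t. exp (- (1 - h) * t) *\<^sub>R f t)"
proof -
  define J where "J n = integral {0..} (\<lambda>t. (exp (- t) * t ^ n / fact n) *\<^sub>R f t)" for n
  define y where "y = integral {0..} (\<lambda>t. exp (- (1 - h) * t) *\<^sub>R f t)"
  define b where "b = (1 - \<omega>) / 2"
  \<comment> \<open>The decay rate that remains after paying \<open>h\<close> for
    \<open>exp (h * t)\<close> and \<open>b\<close> for \<open>t ^ N\<close>.\<close>
  define d where "d = b - h"
  have b: "0 < b" "h < b" and d: "0 < d" and w: "\<omega> < 1"
    using h by (auto simp: b_def d_def)
  have int: "(\<lambda>t. (exp (- t) * t ^ n / fact n) *\<^sub>R f t) integrable_on {0..}" for n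
    by (rule integrable_exp_moment[OF cont f w])
  have inty: "(\<lambda>t. exp (- (1 - h) * t) *\<^sub>R f t) integrable_on {0..}"
    by (rule integral_exp_dominated(1)[OF cont _ f, of _ 1 "- (1 - h)"])
      (use b d in \<open>auto intro!: continuous_intros simp: b_def d_def field_simps\<close>)
  have bound: "norm (y - (\<Sum>n<N. h ^ n *\<^sub>R J n)) \<le> (h / b) ^ N * M / d" for N
  proof -
    let ?g = "\<lambda>t. exp (- (1 - h) * t) - (\<Sum>n<N. h ^ n * (exp (- t) * t ^ n / fact n))"
    have g: "?g t = exp (- t) * (exp (h * t) - (\<Sum>n<N. (h * t) ^ n / fact n))" for t
      by (simp add: algebra_simps sum_distrib_left power_mult_distrib flip: exp_add)
    have "y - (\<Sum>n<N. h ^ n *\<^sub>R J n) = integral {0..} (\<lambda>t. ?g t *\<^sub>R f t)"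
    proof -
      have "((\<lambda>t. exp (- (1 - h) * t) *\<^sub>R f t -
          (\<Sum>n<N. h ^ n *\<^sub>R (exp (- t) * t ^ n / fact n) *\<^sub>R f t)) has_integral
          y - (\<Sum>n<N. h ^ n *\<^sub>R J n)) {0..}"
        unfolding y_def J_def
        by (intro has_integral_diff has_integral_sum has_integral_cmul integrable_integral int inty)
          auto
      then show ?thesis
        by (simp add: scaleR_diff_left scaleR_left.sum integral_unique)
    qed
    moreover have "norm (integral {0..} (\<lambda>t. ?g t *\<^sub>R f t))
        \<le> (h / b) ^ N * M / (- (\<omega> + (h + b - 1)))"
    proof (rule integral_exp_dominated(2)[OF cont _ f])
      show "continuous_on {0..} ?g"
        by (intro continuous_intros) auto
      show "\<omega> + (h + b - 1) < 0"
        using b by (simp add: b_def field_simps)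
      show "\<bar>?g t\<bar> \<le> (h / b) ^ N * exp ((h + b - 1) * t)" if t: "t \<ge> 0" for t
      proof -
        have "0 \<le> h * t" using t h by simp
        from exp_taylor_remainder[OF this, of N]
        have "\<bar>?g t\<bar> \<le> exp (- t) * (exp (h * t) * (h * t) ^ N / fact N)"
          unfolding g abs_mult by (intro mult_mono) auto
        also have "\<dots> = exp (- t) * exp (h * t) * h ^ N * (t ^ N / fact N)"
          by (simp add: power_mult_distrib)
        also have "\<dots> \<le> exp (- t) * exp (h * t) * h ^ N * (inverse (b ^ N) * exp (b * t))"
          using h b t by (intro mult_left_mono power_exp_dominated) auto
        also have "\<dots> = (h / b) ^ N * (exp (- t) * exp (h * t) * exp (b * t))"
          by (simp add: field_simps)
        also have "exp (- t) * exp (h * t) * exp (b * t) = exp ((h + b - 1) * t)"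
          by (simp add: algebra_simps flip: exp_add)
        finally show ?thesis .
      qed
    qed
    moreover have "- (\<omega> + (h + b - 1)) = d"
      by (simp add: d_def b_def field_simps)
    ultimately show ?thesis by simp
  qed
  have "(\<lambda>N. (h / b) ^ N * M / d) \<longlonglongrightarrow> 0 * M / d"
    using h b by (intro tendsto_intros LIMSEQ_power_zero d[THEN less_imp_neq, symmetric]) auto
  then have "(\<lambda>N. (h / b) ^ N * M / d) \<longlonglongrightarrow> 0" by simp
  with always_eventually[OF allI[OF bound]]
  have "(\<lambda>N. y - (\<Sum>n<N. h ^ n *\<^sub>R J n)) \<longlonglongrightarrow> 0"
    by (rule Lim_null_comparison)
  from tendsto_diff[OF tendsto_const[of y] this] have "(\<lambda>n. h ^ n *\<^sub>R J n) sums y"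
    by (simp add: sums_def)
  then show ?thesis
    by (simp only: J_def y_def)
qed

section \<open>The Cesaro kernel: generating function, differences and comparison with Gamma
  values\<close>

lemma cesaro_kernel_eq_pochhammer:
  assumes "\<alpha> > 0"
  shows "cesaro_kernel \<alpha> n = pochhammer \<alpha> n / fact n"
proof -
  have "\<alpha> \<notin> \<int>\<^sub>\<le>\<^sub>0" using assms by (auto elim!: nonpos_Ints_cases)
  then show ?thesis
    by (simp add: cesaro_kernel_def pochhammer_Gamma Gamma_fact add.commute)
qed

lemma cesaro_kernel_0 [simp]: "\<alpha> > 0 \<Longrightarrow> cesaro_kernel \<alpha> 0 = 1"
  by (simp add: cesaro_kernel_eq_pochhammer)

lemma cesaro_kernel_pos: "\<alpha> > 0 \<Longrightarrow> cesaro_kernel \<alpha> n > 0"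
  by (simp add: cesaro_kernel_eq_pochhammer pochhammer_pos)

text \<open>Binomial series with exponent \<open>- \<alpha>\<close> at \<open>- h\<close>; the signs
  of the generalized binomial coefficients and of the powers cancel.\<close>

lemma cesaro_kernel_sums:
  assumes "\<alpha> > 0" "0 < h" "h < 1"
  shows "(\<lambda>n. cesaro_kernel \<alpha> n * h ^ n) sums (1 - h) powr - \<alpha>"
proof -
  have "(- \<alpha> gchoose n) * (- h) ^ n = cesaro_kernel \<alpha> n * h ^ n" for n
    using assms(1) by (simp add: cesaro_kernel_eq_pochhammer gbinomial_pochhammer
        flip: power_mult_distrib)
  then show ?thesis
    using gen_binomial_real[of "- h" "- \<alpha>"] assms by simp
qed

text \<open>On generating functions this is multiplication of
  \<open>(1 - h) powr - (\<alpha> + 1)\<close> by \<open>1 - h\<close>. The proof writes all three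
  values as rational multiples of a common \<open>P\<close>.\<close>

lemma cesaro_kernel_Suc_diff:
  assumes "\<alpha> > 0"
  shows "cesaro_kernel (\<alpha> + 1) (Suc n) - cesaro_kernel (\<alpha> + 1) n = cesaro_kernel \<alpha> (Suc n)"
proof -
  define P where "P = pochhammer (\<alpha> + 1) n / fact n"
  have "cesaro_kernel \<alpha> (Suc n) = \<alpha> / (real n + 1) * P"
    using assms by (simp add: cesaro_kernel_eq_pochhammer pochhammer_rec P_def add.commute)
  moreover have "cesaro_kernel (\<alpha> + 1) (Suc n) = (\<alpha> + (real n + 1)) / (real n + 1) * P"
    using assms by (simp add: cesaro_kernel_eq_pochhammer pochhammer_rec' P_def add_ac)
  moreover have "cesaro_kernel (\<alpha> + 1) n = P"
    using assms by (simp add: cesaro_kernel_eq_pochhammer P_def)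
  ultimately show ?thesis by (simp add: add_divide_distrib distrib_right)
qed

lemma cesaro_kernel_le:
  assumes "\<alpha> > 0"
  shows "cesaro_kernel \<alpha> n \<le> cesaro_kernel (\<alpha> + 1) n"
  using assms cesaro_kernel_Suc_diff[OF assms, of "n - 1"] cesaro_kernel_pos[of "\<alpha> + 1" "n - 1"]
  by (cases n) auto

text \<open>By the functional equation of Gamma the right side is the left side times
  \<open>(n + \<alpha> + 1) / (n + 1)\<close>, which is at least 1. The index \<open>Suc n\<close>
  matches the fractional sum in which the \<open>n\<close>-th moment appears.\<close>

lemma Gamma_div_fact_le_cesaro_kernel:
  assumes "\<alpha> > 0"
  shows "Gamma (real n + \<alpha> + 1) / fact n \<le> Gamma (\<alpha> + 1) * cesaro_kernel (\<alpha> + 1) (Suc n)"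
proof -
  have "Gamma (real n + \<alpha> + 1 + 1) = (real n + \<alpha> + 1) * Gamma (real n + \<alpha> + 1)"
    using assms by (intro Gamma_plus1) (auto elim!: nonpos_Ints_cases)
  then have "Gamma (\<alpha> + 1) * cesaro_kernel (\<alpha> + 1) (Suc n) =
      (real n + \<alpha> + 1) / (real n + 1) * (Gamma (real n + \<alpha> + 1) / fact n)"
    using assms Gamma_real_pos[of "\<alpha> + 1"] Gamma_fact[of "Suc n", where 'a=real]
    by (simp add: cesaro_kernel_def add_ac less_imp_neq[THEN not_sym])
  moreover have "1 * (Gamma (real n + \<alpha> + 1) / fact n) \<le>
      (real n + \<alpha> + 1) / (real n + 1) * (Gamma (real n + \<alpha> + 1) / fact n)"
    using assms by (intro mult_right_mono) (auto simp: Gamma_real_pos less_imp_le)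
  ultimately show ?thesis by simp
qed

section \<open>Recursion for fractional sums of powers\<close>

text \<open>Split off the term \<open>j = 0\<close>; every other term contains a factor
  \<open>R\<close>, and lowering \<open>j\<close> by one leaves the kernel argument
  unchanged.\<close>

lemma frac_sum_Suc:
  assumes "bounded_linear R" "\<alpha> > 0"
  shows "frac_sum \<alpha> (\<lambda>j. R ^^ j) (Suc n) x =
    R (frac_sum \<alpha> (\<lambda>j. R ^^ j) n x) + cesaro_kernel \<alpha> (Suc n) *\<^sub>R x"
proof -
  interpret bounded_linear R by fact
  show ?thesis
    by (simp add: frac_sum_def sum.atMost_Suc_shift sum scaleR add.commute del: sum.atMost_Suc)
qed

lemma frac_sum_0: "\<alpha> > 0 \<Longrightarrow> frac_sum \<alpha> (\<lambda>j. R ^^ j) 0 x = x"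
  by (simp add: frac_sum_def)

section \<open>Resolvents, and the moments of the semigroup\<close>

lemma scaleC_one: "1 *\<^sub>C x = (x :: 'a::complex_banach)"
  using scaleC_of_real[of 1 x] by simp

lemma resolvent_in_domain:
  assumes "l \<in> resolvent_set D A"
  shows "resolvent D A l x \<in> D" and "l *\<^sub>C resolvent D A l x - A (resolvent D A l x) = x"
proof -
  have bij: "bij_betw (\<lambda>x. l *\<^sub>C x - A x) D UNIV"
    using assms by (simp add: resolvent_set_def)
  then show "resolvent D A l x \<in> D"
    unfolding resolvent_def using bij_betwE[OF bij_betw_the_inv_into[OF bij]] by auto
  show "l *\<^sub>C resolvent D A l x - A (resolvent D A l x) = x"
    unfolding resolvent_def using f_the_inv_into_f_bij_betw[OF bij, of x] by simp
qed

lemma resolvent_eqI: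
  assumes "l \<in> resolvent_set D A" "y \<in> D" "l *\<^sub>C y - A y = x"
  shows "resolvent D A l x = y"
  using assms the_inv_into_f_f[of "\<lambda>x. l *\<^sub>C x - A x" D y]
  by (auto simp: resolvent_set_def resolvent_def bij_betw_def)

lemma bounded_clinear_norm_le:
  "bounded_clinear T \<Longrightarrow> norm (T x) \<le> onorm T * norm x"
  by (simp add: bounded_clinear_def onorm)

text \<open>The vector \<open>y x\<close> is a multiple of the resolvent at \<open>1 - h\<close>, so
  it solves an equation for \<open>1 - h - A\<close>; adding \<open>h *\<^sub>R y x\<close> to both
  sides turns this into an equation for \<open>1 - A\<close>, which \<open>R\<close>
  inverts.\<close>

lemma generator_laplace_eq:
  fixes S :: "real \<Rightarrow> 'a::complex_banach \<Rightarrow> 'a"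
  assumes gen: "generator \<alpha> \<omega> S D A" and "\<omega> < 1" "0 < h" "h < 1" "h < 1 - \<omega>"
  defines "R \<equiv> resolvent D A 1"
    and "y \<equiv> \<lambda>x. integral {0..} (\<lambda>t. exp (- (1 - h) * t) *\<^sub>R S t x)"
  shows "y x = (1 - h) powr - \<alpha> *\<^sub>R R x + h *\<^sub>R R (y x)"
proof -
  have res: "Re l > \<omega> \<Longrightarrow> l \<in> resolvent_set D A" for l
    using gen by (auto simp: generator_def)
  have D: "c *\<^sub>R z \<in> D" "A (c *\<^sub>R z) = c *\<^sub>R A z" if "z \<in> D" for c z
    using gen that unfolding generator_def closed_operator_def
    by (metis scaleC_of_real)+
  define l where "l = complex_of_real (1 - h)"
  define p where "p = (1 - h) powr \<alpha>"
  have l: "Re l > \<omega>" using assms by (simp add: l_def)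
  have "p > 0" using assms by (simp add: p_def)
  define z where "z = resolvent D A l x"
  have z: "z \<in> D" "(1 - h) *\<^sub>R z - A z = x"
    using resolvent_in_domain[OF res[OF l], of x] scaleC_of_real[of "1 - h" z]
    by (simp_all add: z_def l_def)
  have "z = (l powr complex_of_real \<alpha>) *\<^sub>C integral {0..} (\<lambda>t. exp (- l * complex_of_real t) *\<^sub>C S t x)"
    using gen l by (simp add: generator_def z_def)
  also have "(\<lambda>t. exp (- l * complex_of_real t) *\<^sub>C S t x) = (\<lambda>t. exp (- (1 - h) * t) *\<^sub>R S t x)"
  proof
    fix t
    have "exp (- l * complex_of_real t) = complex_of_real (exp (- (1 - h) * t))"
      by (simp add: l_def flip: exp_of_real)
    then show "exp (- l * complex_of_real t) *\<^sub>C S t x = exp (- (1 - h) * t) *\<^sub>R S t x"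
      by (simp only: scaleC_of_real)
  qed
  \<comment> \<open>For a nonnegative real base the principal branch is the real power, so
    everything becomes real scaling.\<close>
  also have "l powr complex_of_real \<alpha> = complex_of_real p"
    using assms unfolding l_def p_def by (intro powr_of_real) simp
  finally have zy: "z = p *\<^sub>R y x" by (simp add: scaleC_of_real y_def)
  then have y: "y x = inverse p *\<^sub>R z" using \<open>p > 0\<close> by simp
  have yD: "y x \<in> D" unfolding y by (intro D z)
  have "(1 - h) *\<^sub>R y x - A (y x) = inverse p *\<^sub>R x"
    unfolding y D(2)[OF z(1)] using z(2) by (metis scaleR_left_commute scaleR_right_diff_distrib)
  then have "1 *\<^sub>C y x - A (y x) = inverse p *\<^sub>R x + h *\<^sub>R y x"
    by (simp add: scaleC_one algebra_simps)
  from resolvent_eqI[OF res yD this] have "R (inverse p *\<^sub>R x + h *\<^sub>R y x) = y x"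
    using \<open>\<omega> < 1\<close> by (simp add: R_def)
  moreover have "bounded_linear R"
    using res[of 1] \<open>\<omega> < 1\<close> by (simp add: R_def resolvent_set_def bounded_clinear_def)
  ultimately show ?thesis
    by (simp add: p_def powr_minus bounded_linear.linear linear_add linear_scale)
qed

text \<open>Comparing coefficients of \<open>h\<close> shows that the moments obey the recursion of
  \<open>frac_sum_Suc\<close> after \<open>R\<close> is applied to it. The moment thus lies in the
  range of \<open>R\<close>, that is, in \<open>D\<close>.\<close>

lemma exp_moment_eq_resolvent_frac_sum:
  fixes S :: "real \<Rightarrow> 'a::complex_banach \<Rightarrow> 'a"
  assumes gen: "generator \<alpha> \<omega> S D A" and "\<alpha> > 0" "\<omega> < 1"
    and cont: "continuous_on {0..} (\<lambda>t. S t x)"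
    and growth: "\<And>t. t \<ge> 0 \<Longrightarrow> norm (S t x) \<le> M * exp (\<omega> * t)"
  defines "R \<equiv> resolvent D A 1"
  shows "integral {0..} (\<lambda>t. (exp (- t) * t ^ n / fact n) *\<^sub>R S t x) =
    R (frac_sum \<alpha> (\<lambda>j. R ^^ j) n x)"
proof -
  define J where "J n = integral {0..} (\<lambda>t. (exp (- t) * t ^ n / fact n) *\<^sub>R S t x)" for n
  have R: "bounded_linear R"
    using gen \<open>\<omega> < 1\<close> by (simp add: R_def generator_def resolvent_set_def bounded_clinear_def)
  \<comment> \<open>The coefficients of
    \<open>y - (1 - h) powr - \<alpha> *\<^sub>R R x - h *\<^sub>R R y\<close>. The factor
    \<open>h\<close> in the last term shifts its index, hence the value 0 at index 0.\<close>
  define a where "a n = J n - cesaro_kernel \<alpha> n *\<^sub>R R x -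
    (case n of 0 \<Rightarrow> 0 | Suc m \<Rightarrow> R (J m))" for n
  have "a n = 0" for n
  proof (rule powser_zero_coeff)
    \<comment> \<open>The bound 1 serves the binomial series, the bound
      \<open>(1 - \<omega>) / 2\<close> the expansion into moments.\<close>
    show "min 1 ((1 - \<omega>) / 2) > 0" using \<open>\<omega> < 1\<close> by simp
    fix h :: real
    assume h: "0 < h" "h < min 1 ((1 - \<omega>) / 2)"
    define y where "y = integral {0..} (\<lambda>t. exp (- (1 - h) * t) *\<^sub>R S t x)"
    have J: "(\<lambda>n. h ^ n *\<^sub>R J n) sums y"
      unfolding J_def y_def using h by (intro laplace_sums_exp_moments[OF cont growth]) auto
    from sums_scaleR_right[OF bounded_linear.sums[OF R J], of h]
    have "(\<lambda>n. h ^ Suc n *\<^sub>R R (J n)) sums (h *\<^sub>R R y)"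
      by (simp add: linear_scale[OF bounded_linear.linear[OF R]])
    then have RJ: "(\<lambda>n. h ^ n *\<^sub>R (case n of 0 \<Rightarrow> 0 | Suc m \<Rightarrow> R (J m))) sums (h *\<^sub>R R y)"
      by (subst (asm) sums_Suc_iff[of "\<lambda>n. h ^ n *\<^sub>R (case n of 0 \<Rightarrow> 0 | Suc m \<Rightarrow> R (J m))",
            simplified nat.case]) simp
    have K: "(\<lambda>n. (cesaro_kernel \<alpha> n * h ^ n) *\<^sub>R R x) sums ((1 - h) powr - \<alpha> *\<^sub>R R x)"
      using h \<open>\<alpha> > 0\<close> by (intro sums_scaleR_left cesaro_kernel_sums) auto
    have "y = (1 - h) powr - \<alpha> *\<^sub>R R x + h *\<^sub>R R y"
      unfolding y_def R_def using h \<open>\<omega> < 1\<close>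
      by (intro generator_laplace_eq[OF gen]) auto
    with sums_diff[OF sums_diff[OF J K] RJ] show "(\<lambda>n. h ^ n *\<^sub>R a n) sums 0"
      by (simp add: a_def algebra_simps)
  qed
  then have a: "J n = cesaro_kernel \<alpha> n *\<^sub>R R x + (case n of 0 \<Rightarrow> 0 | Suc m \<Rightarrow> R (J m))" for n
    by (simp add: a_def algebra_simps)
  have "J n = R (frac_sum \<alpha> (\<lambda>j. R ^^ j) n x)"
  proof (induction n)
    case 0
    then show ?case using a[of 0] \<open>\<alpha> > 0\<close> by (simp add: frac_sum_0)
  next
    case (Suc n)
    then show ?case
      using a[of "Suc n"] bounded_linear.linear[OF R]
      by (simp add: frac_sum_Suc[OF R \<open>\<alpha> > 0\<close>] linear_add linear_scale)
  qed
  then show ?thesis by (simp only: J_def)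
qed

section \<open>Moments under temperate growth\<close>

text \<open>The integrand is dominated by a Gamma integrand. The growth bound covers only
  \<open>t > 0\<close>; at the endpoint both sides vanish because \<open>f 0 = 0\<close>.\<close>

lemma exp_moment_norm_le:
  fixes f :: "real \<Rightarrow> 'a::banach"
  assumes "\<alpha> > 0" and int: "(\<lambda>t. (exp (- t) * t ^ n / fact n) *\<^sub>R f t) integrable_on {0..}"
    and f: "\<And>t. t > 0 \<Longrightarrow> norm (f t) \<le> M * t powr \<alpha>" and "f 0 = 0"
  shows "norm (integral {0..} (\<lambda>t. (exp (- t) * t ^ n / fact n) *\<^sub>R f t))
    \<le> M * (Gamma (real n + \<alpha> + 1) / fact n)"
proof -
  have "((\<lambda>t. t powr (real n + \<alpha> + 1 - 1) / exp t) has_integral Gamma (real n + \<alpha> + 1)) {0..}"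
    using assms by (intro Gamma_integral_real) auto
  from has_integral_mult_right[OF this, of "M / fact n"]
  have G: "((\<lambda>t. M / fact n * (t powr (real n + \<alpha>) / exp t)) has_integral
      M * (Gamma (real n + \<alpha> + 1) / fact n)) {0..}"
    by simp
  have "norm ((exp (- t) * t ^ n / fact n) *\<^sub>R f t) \<le> M / fact n * (t powr (real n + \<alpha>) / exp t)"
    if "t \<in> {0..}" for t
  proof (cases "t = 0")
    case False
    then have t: "t > 0" using that by simp
    then have "norm ((exp (- t) * t ^ n / fact n) *\<^sub>R f t) \<le>
        (exp (- t) * t ^ n / fact n) * (M * t powr \<alpha>)"
      using f[OF t] t by (simp only: norm_scaleR) (intro mult_mono, auto)
    also have "\<dots> = M / fact n * (t powr (real n + \<alpha>) / exp t)"
      using t by (simp add: powr_add powr_realpow exp_minus field_simps)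
    finally show ?thesis .
  qed (use assms in auto)
  from integral_norm_bound_integral[OF int has_integral_integrable[OF G] this]
  show ?thesis using integral_unique[OF G] by simp
qed

section \<open>The two resolvent formulas and Cesaro boundedness\<close>

theorem theorem4:
  fixes S :: "real \<Rightarrow> 'a::complex_banach \<Rightarrow> 'a"
    and D :: "'a set" and A :: "'a \<Rightarrow> 'a"
    and \<alpha> C \<omega> :: real
  assumes "\<alpha> > 0"
    and "integrated_semigroup \<alpha> S"
    and "nondegenerate S"
    and "C > 0" and "0 \<le> \<omega>" and "\<omega> < 1"
    and "\<And>t. t \<ge> 0 \<Longrightarrow> onorm (S t) \<le> C * exp (\<omega> * t)"
    and "generator \<alpha> \<omega> S D A"
  shows "1 \<in> resolvent_set D A \<and>
    (\<forall>x. \<forall>n.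
      (\<lambda>t. (exp (- t) * t ^ n / fact n) *\<^sub>R S t x) integrable_on {0..} \<and>
      integral {0..} (\<lambda>t. (exp (- t) * t ^ n / fact n) *\<^sub>R S t x) \<in> D \<and>
      frac_sum \<alpha> (\<lambda>j. resolvent D A 1 ^^ j) n x =
        integral {0..} (\<lambda>t. (exp (- t) * t ^ n / fact n) *\<^sub>R S t x)
        - A (integral {0..} (\<lambda>t. (exp (- t) * t ^ n / fact n) *\<^sub>R S t x))) \<and>
    (\<forall>x. \<forall>n\<ge>1.
      (\<lambda>t. (exp (- t) * t ^ (n - 1) / fact (n - 1)) *\<^sub>R S t x) integrable_on {0..} \<and>
      frac_sum \<alpha> (\<lambda>j. resolvent D A 1 ^^ j) n x =
        integral {0..} (\<lambda>t. (exp (- t) * t ^ (n - 1) / fact (n - 1)) *\<^sub>R S t x)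
        + cesaro_kernel (\<alpha> + 1) n *\<^sub>R x - cesaro_kernel (\<alpha> + 1) (n - 1) *\<^sub>R x) \<and>
    (temperate_growth \<alpha> S \<longrightarrow> cesaro_bounded \<alpha> (resolvent D A 1))"
  proof -
  note \<alpha> = \<open>\<alpha> > 0\<close> and gen = \<open>generator \<alpha> \<omega> S D A\<close>
  define R where "R = resolvent D A 1"
  define J where "J n x = integral {0..} (\<lambda>t. (exp (- t) * t ^ n / fact n) *\<^sub>R S t x)" for n x
  let ?F = "\<lambda>n. frac_sum \<alpha> (\<lambda>j. R ^^ j) n"
  have one: "1 \<in> resolvent_set D A"
    using gen \<open>\<omega> < 1\<close> by (simp add: generator_def)
  have cR: "bounded_clinear R" and R: "bounded_linear R"
    using one by (simp_all add: R_def resolvent_set_def bounded_clinear_def)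
  have S: "bounded_clinear (S t)" if "t \<ge> 0" for t
    using assms(2) that by (simp add: integrated_semigroup_def)
  have S0: "S 0 x = 0" and cont: "continuous_on {0..} (\<lambda>t. S t x)" for x
    using assms(2) by (simp_all add: integrated_semigroup_def)
  have growth: "norm (S t x) \<le> (C * norm x) * exp (\<omega> * t)" if "t \<ge> 0" for t x
  proof -
    have "norm (S t x) \<le> onorm (S t) * norm x"
      by (rule bounded_clinear_norm_le[OF S[OF that]])
    also have "\<dots> \<le> C * exp (\<omega> * t) * norm x"
      by (intro mult_right_mono assms(7) that) auto
    finally show ?thesis by (simp add: mult_ac)
  qed
  have int: "(\<lambda>t. (exp (- t) * t ^ n / fact n) *\<^sub>R S t x) integrable_on {0..}" for n x
    by (rule integrable_exp_moment[OF cont growth \<open>\<omega> < 1\<close>])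
  have J: "J n x = R (?F n x)" for n x
    unfolding J_def R_def
    by (rule exp_moment_eq_resolvent_frac_sum[OF gen \<alpha> \<open>\<omega> < 1\<close> cont growth])
  \<comment> \<open>\<open>J n x\<close> is \<open>R\<close> applied to the fractional sum, and
    \<open>1 - A\<close> undoes \<open>R\<close>.\<close>
  have first: "J n x \<in> D" "?F n x = J n x - A (J n x)" for n x
    using resolvent_in_domain[OF one, of "?F n x"] by (simp_all add: J R_def scaleC_one)
  have FSuc: "?F (Suc n) x = J n x + cesaro_kernel \<alpha> (Suc n) *\<^sub>R x" for n x
    by (simp add: frac_sum_Suc[OF R \<alpha>] J)
  \<comment> \<open>The kernel of order \<open>\<alpha>\<close> in \<open>FSuc\<close> is rewritten
    as a difference of kernels of order \<open>\<alpha> + 1\<close>.\<close>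
  have second: "?F n x = J (n - 1) x + cesaro_kernel (\<alpha> + 1) n *\<^sub>R x
      - cesaro_kernel (\<alpha> + 1) (n - 1) *\<^sub>R x" if "n \<ge> 1" for n x
    using that FSuc[of "n - 1" x] cesaro_kernel_Suc_diff[OF \<alpha>, of "n - 1"]
    by (simp add: algebra_simps flip: scaleR_add_left)
  have third: "cesaro_bounded \<alpha> R" if temperate: "temperate_growth \<alpha> S"
  proof -
    obtain K where K: "\<And>t. t > 0 \<Longrightarrow> onorm (S t) \<le> K * t powr \<alpha>"
      using temperate unfolding temperate_growth_def by blast
    have K0: "K \<ge> 0"
      using K[of 1] onorm_pos_le[of "S 1"] S[of 1] by (simp add: bounded_clinear_def)
    \<comment> \<open>\<open>K * Gamma (\<alpha> + 1)\<close> pays for the moment and 1 for the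
      kernel term; the 1 also covers \<open>n = 0\<close>, where the fractional sum is
      \<open>x\<close> itself and no preceding moment exists.\<close>
    define B where "B = K * Gamma (\<alpha> + 1) + 1"
    have G: "Gamma (\<alpha> + 1) > 0" using \<alpha> by (intro Gamma_real_pos) simp
    have B: "B \<ge> 1" using K0 G by (simp add: B_def)
    have pos: "cesaro_kernel (\<alpha> + 1) n > 0" for n
      using \<alpha> by (intro cesaro_kernel_pos) simp
    have bound: "norm (?F n x) \<le> B * cesaro_kernel (\<alpha> + 1) n * norm x" for n x
    proof (cases n)
      case 0
      then show ?thesis using B \<alpha> mult_right_mono[of 1 B "norm x"] by (simp add: frac_sum_0)
    next
      case (Suc m)
      have "norm (J m x) \<le> (K * norm x) * (Gamma (real m + \<alpha> + 1) / fact m)"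
        unfolding J_def
      proof (rule exp_moment_norm_le[OF \<alpha> int _ S0])
        fix t :: real assume t: "t > 0"
        have "norm (S t x) \<le> onorm (S t) * norm x"
          using t by (intro bounded_clinear_norm_le S) simp
        also have "\<dots> \<le> K * t powr \<alpha> * norm x"
          by (intro mult_right_mono K t) simp
        finally show "norm (S t x) \<le> K * norm x * t powr \<alpha>" by (simp add: mult_ac)
      qed
      also have "\<dots> \<le> (K * norm x) * (Gamma (\<alpha> + 1) * cesaro_kernel (\<alpha> + 1) n)"
        unfolding Suc using K0 by (intro mult_left_mono Gamma_div_fact_le_cesaro_kernel \<alpha>) auto
      finally have "norm (J m x) \<le> \<dots>" .
      moreover have "norm (cesaro_kernel \<alpha> n *\<^sub>R x) \<le> cesaro_kernel (\<alpha> + 1) n * norm x"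
        using cesaro_kernel_le[OF \<alpha>, of n] cesaro_kernel_pos[OF \<alpha>, of n]
        by (simp add: mult_right_mono)
      moreover have "?F n x = J m x + cesaro_kernel \<alpha> n *\<^sub>R x"
        by (simp only: Suc FSuc)
      ultimately have "norm (?F n x) \<le> (K * norm x) * (Gamma (\<alpha> + 1) * cesaro_kernel (\<alpha> + 1) n)
          + cesaro_kernel (\<alpha> + 1) n * norm x"
        by (metis norm_triangle_mono)
      then show ?thesis by (simp add: B_def algebra_simps)
    qed
    have "1 / cesaro_kernel (\<alpha> + 1) n * onorm (?F n) \<le> B" for n
    proof -
      have "onorm (?F n) \<le> B * cesaro_kernel (\<alpha> + 1) n"
        using B pos[of n] by (intro onorm_bound bound) auto
      then show ?thesis using pos[of n] by (simp add: field_simps)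
    qed
    then show ?thesis
      unfolding cesaro_bounded_def using cR by (auto intro!: bdd_aboveI)
  qed
  show ?thesis
    using one int first second third unfolding J_def R_def by blast
qed

end
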